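(* Let $p\ge 1$, $\lambda>0$, $\beta>0$, let $M\in\mathbb{R}^{m\times n}_+$ be nonzero, and let $\Omega$, $R_p$, $g$, $h$ be as defined in the context. Let $X_0\in\Omega$ and let $\{X_k\}_{k\ge 0}\subset\mathbb{R}^{n\times n}$ be a sequence generated by the proximal difference-of-convex algorithm with exactly solved subproblems, i.e., for every $k\ge 0$, with $\alpha_k=R_p(X_k)$, $$X_{k+1}\in\operatorname*{argmin}_{X\in\mathbb{R}^{n\times n}}\left\{g(X)-\alpha_k\left\langle X,\frac{X_k}{\|X_k\|_F}\right\rangle+\frac{\beta}{2}\|X-X_k\|_F^2\right\},$$ and assume that $X_k\neq O$ for all $k$. Define $\Phi_k(X)=g(X)-\alpha_k h(X)$. Then for every $k\ge 0$, $$\Phi_k(X_{k+1})+\frac{\beta}{2}\|X_{k+1}-X_k\|_F^2\le\Phi_k(X_k).$$ Moreover, for every $k\ge0$, $X_{k+1}$ satisfies $$0\in\partial g(X_{k+1})-\alpha_k\frac{X_k}{\|X_k\|_F}+\beta(X_{k+1}-X_k).$$ Furthermore, if $X_k\to X^*\neq O$ and $\alpha_k\to\alpha^*$, then $$0\in\partial g(X^* )-\alpha^*\,\partial h(X^* ),$$ i.e., $X^*$ is a critical point of the limiting difference-of-convex problem $\min_X\{g(X)-\alpha^*h(X)\}$.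
   Context: $O$ is the zero matrix, $\langle A,B\rangle=\operatorname{tr}(A^TB)$, $\|\cdot\|_F$ is the Frobenius norm, and $\|\cdot\|_\bullet$ denotes one of two norms on $\mathbb{R}^{n\times n}$, fixed throughout: the entrywise $\ell_1$ norm $\|X\|_1=\sum_{i,j}|x_{ij}|$ or the nuclear norm $\|X\|_*$ (sum of singular values). For $X\ne O$, $R_p(X)=\|X\|_\bullet^p/\|X\|_F$. For a fixed vector $w=(w_1,\dots,w_n)$ of nonnegative weights, the feasible set is $$\Omega=\{X\in\mathbb{R}^{n\times n}_+ : x_{ii}\le 1,\ w_ix_{ij}\le w_jx_{ii},\ i,j=1,\dots,n\},$$ where $\mathbb{R}^{n\times n}_+$ is the set of entrywise nonnegative matrices. The indicator function $\mathbb{I}_\Omega$ equals $0$ on $\Omega$ and $+\infty$ off $\Omega$. Define $$g(X)=\lambda\|X\|_\bullet^p+\tfrac12\|MX-M\|_F^2+\mathbb{I}_\Omega(X),\qquad h(X)=\|X\|_F.$$ Here $\partial$ denotes the subdifferential of convex analysis (both $g$ and $h$ are convex, and $\partial h(X)=\{X/\|X\|_F\}$ for $X\ne O$). The algorithm's stopping tests are disregarded, so the sequence is infinite. *)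

theory Defs
  imports "HOL-Analysis.Analysis"
begin

text \<open>
  Matrices carry the library's Euclidean structure, so \<^const>\<open>norm\<close> is the Frobenius norm and
  \<^const>\<open>inner\<close> is the trace inner product (not an operator norm).
\<close>

lemma matrix_inner_eq_trace:
  fixes A B :: "real ^ 'n ^ 'm"
  shows "A \<bullet> B = trace (transpose A ** B)"
  unfolding inner_vec_def trace_def transpose_def matrix_matrix_mult_def
  by (simp, rule sum.swap)

lemma matrix_norm_eq_frobenius:
  fixes A :: "real ^ 'n ^ 'm"
  shows "norm A = sqrt (\<Sum>i\<in>UNIV. \<Sum>j\<in>UNIV. (A $ i $ j)\<^sup>2)"
  by (simp add: norm_eq_sqrt_inner inner_vec_def power2_eq_square)

definition l1_norm :: "real ^ 'n ^ 'n \<Rightarrow> real" where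
  "l1_norm X = (\<Sum>i\<in>UNIV. \<Sum>j\<in>UNIV. \<bar>X $ i $ j\<bar>)"

definition eigenspace :: "real ^ 'n ^ 'n \<Rightarrow> real \<Rightarrow> (real ^ 'n) set" where
  "eigenspace A \<mu> = {v. A *v v = \<mu> *\<^sub>R v}"

definition singular_values :: "real ^ 'n ^ 'n \<Rightarrow> real set" where
  "singular_values X = {\<sigma>. 0 \<le> \<sigma> \<and> eigenspace (transpose X ** X) (\<sigma>\<^sup>2) \<noteq> {0}}"

text \<open>
  Each singular value is counted with the multiplicity of the eigenvalue \<open>\<sigma>\<^sup>2\<close> of the symmetric
  matrix \<open>X\<^sup>T X\<close>, for which geometric and algebraic multiplicity agree.
\<close>

definition nuclear_norm :: "real ^ 'n ^ 'n \<Rightarrow> real" where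
  "nuclear_norm X =
     (\<Sum>\<sigma>\<in>singular_values X. real (dim (eigenspace (transpose X ** X) (\<sigma>\<^sup>2))) * \<sigma>)"

text \<open>The sum above is never the default value of a sum over an infinite set.\<close>

lemma finite_singular_values: "finite (singular_values X)"
proof -
  define A where "A = transpose X ** X"
  have symA: "transpose A = A"
    by (simp add: A_def matrix_transpose_mul)
  have "\<exists>v. A *v v = \<sigma>\<^sup>2 *\<^sub>R v \<and> v \<noteq> 0" if "\<sigma> \<in> singular_values X" for \<sigma>
  proof -
    have "0 \<in> eigenspace A (\<sigma>\<^sup>2)" by (simp add: eigenspace_def)
    then show ?thesis
      using that by (auto simp: singular_values_def A_def[symmetric] eigenspace_def)
  qed
  then obtain v where v: "\<And>\<sigma>. \<sigma> \<in> singular_values X \<Longrightarrow> A *v v \<sigma> = \<sigma>\<^sup>2 *\<^sub>R v \<sigma> \<and> v \<sigma> \<noteq> 0"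
    by metis
  have orth: "orthogonal (v s) (v t)"
    if s: "s \<in> singular_values X" and t: "t \<in> singular_values X" and "s \<noteq> t" for s t
  proof -
    have "s\<^sup>2 \<noteq> t\<^sup>2"
      using that by (auto simp: singular_values_def)
    moreover have "(A *v v s) \<bullet> v t = v s \<bullet> (A *v v t)"
      by (metis dot_lmul_matrix symA transpose_matrix_vector)
    then have "s\<^sup>2 * (v s \<bullet> v t) = t\<^sup>2 * (v s \<bullet> v t)"
      using v[OF s] v[OF t] by simp
    ultimately show ?thesis
      by (simp add: orthogonal_def)
  qed
  have "inj_on v (singular_values X)"
    by (rule inj_onI) (metis orth v orthogonal_self)
  moreover have "finite (v ` singular_values X)"
    by (rule pairwise_orthogonal_imp_finite) (use orth in \<open>force simp: pairwise_def\<close>)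
  ultimately show ?thesis
    by (rule finite_imageD[rotated])
qed

definition R_ratio :: "(real ^ 'n ^ 'n \<Rightarrow> real) \<Rightarrow> real \<Rightarrow> real ^ 'n ^ 'n \<Rightarrow> real" where
  "R_ratio nrm p X = nrm X powr p / norm X"

definition Omega :: "real ^ 'n \<Rightarrow> (real ^ 'n ^ 'n) set" where
  "Omega w = {X. (\<forall>i j. 0 \<le> X $ i $ j) \<and>
                 (\<forall>i j. X $ i $ i \<le> 1 \<and> w $ i * X $ i $ j \<le> w $ j * X $ i $ i)}"

definition convex_indicator :: "'a set \<Rightarrow> 'a \<Rightarrow> ereal" where
  "convex_indicator S x = (if x \<in> S then 0 else \<infinity>)"

definition g_fun ::
  "(real ^ 'n ^ 'n \<Rightarrow> real) \<Rightarrow> real \<Rightarrow> real \<Rightarrow> real ^ 'n ^ 'm \<Rightarrow> real ^ 'n \<Rightarrow> real ^ 'n ^ 'n \<Rightarrow> ereal"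
where
  "g_fun nrm p lam M w X =
     ereal (lam * nrm X powr p + 1/2 * (norm (M ** X - M))\<^sup>2) + convex_indicator (Omega w) X"

definition h_fun :: "real ^ 'n ^ 'n \<Rightarrow> ereal" where
  "h_fun X = ereal (norm X)"

definition subdifferential :: "('a::real_inner \<Rightarrow> ereal) \<Rightarrow> 'a \<Rightarrow> 'a set" where
  "subdifferential f x =
     {s. \<bar>f x\<bar> \<noteq> \<infinity> \<and> (\<forall>y. f x + ereal (s \<bullet> (y - x)) \<le> f y)}"

end

theory Submission
  imports Defs
begin

text \<open>
  The nuclear norm is convex because it is a support function: \<open>\<parallel>X\<parallel>\<^sub>*\<close> is the maximum of
  \<open>\<Sum>\<^sub>b c\<^sub>b \<bullet> X b\<close> over orthonormal bases \<open>b\<close> and orthogonal families \<open>c\<close> in the unit ball, attained at an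
  eigenbasis \<open>b\<close> of \<open>X\<^sup>T X\<close> with \<open>c\<^sub>b = X b / \<parallel>X b\<parallel>\<close>.  Hence \<open>g\<close> is a continuous convex function
  restricted to the closed convex set \<open>\<Omega>\<close>.  Comparing \<open>X\<^sub>k\<^sub>+\<^sub>1\<close> with \<open>X\<^sub>k\<close> in the subproblem and bounding
  \<open>\<langle>X\<^sub>k\<^sub>+\<^sub>1, X\<^sub>k / \<parallel>X\<^sub>k\<parallel>\<rangle>\<close> by \<open>\<parallel>X\<^sub>k\<^sub>+\<^sub>1\<parallel>\<close> gives the descent inequality; comparing it with points of a segment in
  \<open>\<Omega>\<close> gives the optimality condition, and closedness of the graph of \<open>\<partial>g\<close> gives the limit statement.
\<close>

subsection \<open>Orthonormal eigenbases\<close>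

text \<open>The remainder \<open>y\<close> is orthogonal to every element of \<open>B\<close>, hence
  to \<open>span B = UNIV\<close>, hence to itself.\<close>

lemma orthonormal_basis_expansion:
  fixes B :: "'a::euclidean_space set"
  assumes "finite B" "pairwise orthogonal B" "\<And>b. b \<in> B \<Longrightarrow> norm b = 1" "span B = UNIV"
  shows "x = (\<Sum>b\<in>B. (x \<bullet> b) *\<^sub>R b)"
proof -
  define y where "y = x - (\<Sum>b\<in>B. (x \<bullet> b) *\<^sub>R b)"
  have "orthogonal y b" if b: "b \<in> B" for b
  proof -
    have "(\<Sum>c\<in>B. (x \<bullet> c) * (c \<bullet> b)) = (\<Sum>c\<in>B. if c = b then x \<bullet> b else 0)"
      using assms(2,3) b by (intro sum.cong) (auto simp: pairwise_def orthogonal_def norm_eq_1)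
    then show ?thesis
      using b assms(1) by (simp add: y_def orthogonal_def inner_diff_left inner_sum_left)
  qed
  then have "orthogonal y y"
    using orthogonal_to_span assms(4) by blast
  then show ?thesis
    by (simp add: orthogonal_self y_def)
qed

text \<open>Rayleigh's principle: \<open>v\<close> maximises the quadratic form of \<open>f\<close>
  over the compact unit sphere of \<open>S\<close>. The residual \<open>u = f v - \<mu> v\<close>
  lies in \<open>S\<close> and is orthogonal to \<open>v\<close>. Moving from \<open>v\<close>
  towards \<open>u\<close> would raise the form to first order unless \<open>u = 0\<close>.\<close>

lemma self_adjoint_eigenvector:
  fixes f :: "'a::euclidean_space \<Rightarrow> 'a"
  assumes lin: "linear f" and adj: "\<And>u v. f u \<bullet> v = u \<bullet> f v"
    and S: "subspace S" "f ` S \<subseteq> S" "S \<noteq> {0}"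
  obtains v where "v \<in> S" "norm v = 1" "f v = (v \<bullet> f v) *\<^sub>R v"
proof -
  interpret linear f by fact
  obtain z where z: "z \<in> S" "z \<noteq> 0"
    using S subspace_0 by blast
  let ?K = "S \<inter> sphere 0 1"
  have "z /\<^sub>R norm z \<in> ?K"
    using z S by (simp add: subspace_scale)
  then have "?K \<noteq> {}" by blast
  moreover have "compact ?K"
    by (simp add: S closed_subspace closed_Int_compact)
  moreover have "continuous_on ?K (\<lambda>v. v \<bullet> f v)"
    by (intro continuous_intros linear_continuous_on lin) (simp add: lin linear_conv_bounded_linear[symmetric])
  ultimately obtain v where v: "v \<in> ?K" and max: "\<And>y. y \<in> ?K \<Longrightarrow> y \<bullet> f y \<le> v \<bullet> f v"
    using continuous_attains_sup by metis
  have vS: "v \<in> S" and v1: "norm v = 1" using v by auto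
  define \<mu> where "\<mu> = v \<bullet> f v"
  \<comment> \<open>Homogeneity of degree two carries the maximum from the sphere to all of
    \<open>S\<close>, so that the vectors \<open>v + t *\<^sub>R u\<close> can be tested without
    normalising them.\<close>
  have bound: "y \<bullet> f y \<le> \<mu> * (norm y)\<^sup>2" if "y \<in> S" for y
  proof (cases "y = 0")
    case False
    then have "y /\<^sub>R norm y \<in> ?K" using that S by (simp add: subspace_scale)
    from max[OF this] False show ?thesis
      by (simp add: \<mu>_def scale divide_simps power2_eq_square mult_ac)
  qed (simp add: zero)
  define u where "u = f v - \<mu> *\<^sub>R v"
  have uS: "u \<in> S"
    using S vS by (auto simp: u_def intro!: subspace_diff subspace_scale)
  have vu: "v \<bullet> u = 0"
    using v1 by (simp add: u_def inner_diff_right \<mu>_def[symmetric] norm_eq_1)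
  have ufv: "u \<bullet> f v = u \<bullet> u"
    using vu by (simp add: u_def inner_diff_right inner_commute)
  \<comment> \<open>first-order optimality of \<open>v\<close> in the direction \<open>u\<close>\<close>
  have ineq: "2 * (u \<bullet> u) \<le> t * (\<mu> * (u \<bullet> u) - u \<bullet> f u)" if "0 < t" for t :: real
  proof -
    have "v + t *\<^sub>R u \<in> S" using S uS vS by (simp add: subspace_add subspace_scale)
    from bound[OF this]
    have "\<mu> + 2 * t * (u \<bullet> u) + t * t * (u \<bullet> f u) \<le> \<mu> * (1 + t * t * (u \<bullet> u))"
      using vu v1 ufv adj[of v u]
      by (simp add: add scale inner_add_left inner_add_right power2_norm_eq_inner inner_commute
          norm_eq_1 \<mu>_def algebra_simps)
    then have "t * (2 * (u \<bullet> u)) \<le> t * (t * (\<mu> * (u \<bullet> u) - u \<bullet> f u))"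
      by (simp add: algebra_simps)
    then show ?thesis using that by simp
  qed
  have "((\<lambda>t. t * (\<mu> * (u \<bullet> u) - u \<bullet> f u)) \<longlongrightarrow> 0 * (\<mu> * (u \<bullet> u) - u \<bullet> f u)) (at_right 0)"
    by (intro tendsto_intros)
  then have "2 * (u \<bullet> u) \<le> 0"
    by (intro tendsto_lowerbound[where F = "at_right (0::real)"])
      (auto simp: eventually_at_right_less intro!: eventually_mono[OF eventually_at_right_less] ineq)
  then have "u = 0" by (metis inner_ge_zero inner_eq_zero_iff mult_le_0_iff not_numeral_le_zero order_antisym)
  with vS v1 that show thesis
    by (simp add: u_def \<mu>_def)
qed

subsection \<open>Convexity of the two norms\<close>

lemma gram_inner:
  fixes X :: "real ^ 'n ^ 'm"
  shows "((transpose X ** X) *v u) \<bullet> v = (X *v u) \<bullet> (X *v v)"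
  by (metis dot_lmul_matrix inner_commute matrix_vector_mul_assoc transpose_matrix_vector)

lemma subspace_eigenspace: "subspace (eigenspace A \<mu>)"
  by (auto simp: subspace_def eigenspace_def matrix_vector_right_distrib scaleR_add_right
      matrix_vector_mult_scaleR)

text \<open>Orthonormal bases of the eigenspaces of \<open>transpose X ** X\<close> are glued
  together. On the eigenspace of \<open>\<sigma>\<^sup>2\<close> each unit vector has an image of
  norm \<open>\<sigma>\<close>, so counting basis vectors reproduces the multiplicities in the
  definition. The images stay orthogonal by \<open>gram_inner\<close>.\<close>

lemma nuclear_norm_eigenbasis:
  fixes X :: "real ^ 'n ^ 'n"
  obtains B where "finite B" "pairwise orthogonal B" "\<And>b. b \<in> B \<Longrightarrow> norm b = 1" "span B = UNIV"
    "pairwise (\<lambda>b c. orthogonal (X *v b) (X *v c)) B"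
    "nuclear_norm X = (\<Sum>b\<in>B. norm (X *v b))"
proof -
  define A where "A = transpose X ** X"
  define E where "E \<sigma> = eigenspace A (\<sigma>\<^sup>2)" for \<sigma>
  let ?S = "singular_values X"
  have "\<exists>B. B \<subseteq> E \<sigma> \<and> pairwise orthogonal B \<and> (\<forall>b\<in>B. norm b = 1) \<and> independent B
      \<and> card B = dim (E \<sigma>) \<and> span B = E \<sigma>" for \<sigma>
    unfolding E_def by (rule orthonormal_basis_subspace[OF subspace_eigenspace[of A "\<sigma>\<^sup>2"]]) metis
  then obtain C where C: "\<And>\<sigma>. C \<sigma> \<subseteq> E \<sigma>" "\<And>\<sigma>. pairwise orthogonal (C \<sigma>)"
    "\<And>\<sigma> b. b \<in> C \<sigma> \<Longrightarrow> norm b = 1" "\<And>\<sigma>. independent (C \<sigma>)"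
    "\<And>\<sigma>. card (C \<sigma>) = dim (E \<sigma>)" "\<And>\<sigma>. span (C \<sigma>) = E \<sigma>"
    by metis
  have adj: "(A *v u) \<bullet> v = u \<bullet> (A *v v)" for u v
    unfolding A_def by (metis gram_inner inner_commute)
  have Eeq: "A *v b = \<sigma>\<^sup>2 *\<^sub>R b" if "b \<in> E \<sigma>" for b \<sigma>
    using that by (simp add: E_def eigenspace_def)
  have S_nonneg: "0 \<le> \<sigma>" if "\<sigma> \<in> ?S" for \<sigma>
    using that by (simp add: singular_values_def)
  have orth: "orthogonal b c" if "\<sigma> \<in> ?S" "\<tau> \<in> ?S" "\<sigma> \<noteq> \<tau>" "b \<in> E \<sigma>" "c \<in> E \<tau>" for b c \<sigma> \<tau>
  proof -
    \<comment> \<open>Distinct singular values give distinct eigenvalues because both are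
      nonnegative.\<close>
    have "\<sigma>\<^sup>2 \<noteq> \<tau>\<^sup>2" using that S_nonneg by (metis power2_eq_iff_nonneg)
    moreover have "\<sigma>\<^sup>2 * (b \<bullet> c) = \<tau>\<^sup>2 * (b \<bullet> c)"
      using adj[of b c] that by (simp add: Eeq)
    ultimately show ?thesis by (simp add: orthogonal_def)
  qed
  define B where "B = (\<Union>\<sigma>\<in>?S. C \<sigma>)"
  have finC: "finite (C \<sigma>)" for \<sigma>
    using C(4) independent_imp_finite by blast
  have 1: "finite B"
    by (simp add: B_def finC finite_singular_values)
  have 2: "pairwise orthogonal B"
  proof (rule pairwiseI)
    fix b c assume "b \<in> B" "c \<in> B" "b \<noteq> c"
    then obtain \<sigma> \<tau> where *: "\<sigma> \<in> ?S" "\<tau> \<in> ?S" "b \<in> C \<sigma>" "c \<in> C \<tau>" by (auto simp: B_def)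
    show "orthogonal b c"
    proof (cases "\<sigma> = \<tau>")
      case True
      then show ?thesis using * C(2) \<open>b \<noteq> c\<close> by (metis pairwise_def)
    next
      case False
      then show ?thesis using * C(1) orth by blast
    qed
  qed
  have 3: "norm b = 1" if "b \<in> B" for b
    using that C(3) by (auto simp: B_def)
  have 4: "span B = UNIV"
  proof (rule ccontr)
    assume "span B \<noteq> UNIV"
    \<comment> \<open>The orthogonal complement \<open>T\<close> of \<open>B\<close> is invariant
      under \<open>A\<close>. If it were nonzero it would contain a unit eigenvector
      \<open>v\<close>, which already belongs to an eigenspace spanned by a part of \<open>B\<close>
      and would therefore be orthogonal to itself.\<close>
    define T where "T = {y. \<forall>b\<in>B. orthogonal b y}"
    have "dim B < DIM(real^'n)"
      using \<open>span B \<noteq> UNIV\<close> dim_eq_full[of B] dim_subset_UNIV[of B] by linarith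
    then obtain x where "x \<noteq> 0" "\<And>y. y \<in> span B \<Longrightarrow> orthogonal x y"
      using orthogonal_to_subspace_exists by blast
    then have "T \<noteq> {0}"
      by (auto simp: T_def span_base orthogonal_commute)
    moreover have "subspace T"
      unfolding T_def by (rule subspace_orthogonal_to_vectors)
    moreover have "(*v) A ` T \<subseteq> T"
    proof clarify
      fix y assume y: "y \<in> T"
      have "b \<bullet> (A *v y) = 0" if b: "b \<in> B" for b
      proof -
        obtain \<sigma> where "b \<in> E \<sigma>" using b C(1) unfolding B_def by blast
        then have "b \<bullet> (A *v y) = \<sigma>\<^sup>2 * (b \<bullet> y)" by (simp add: adj[symmetric] Eeq)
        then show ?thesis using y b by (simp add: T_def orthogonal_def)
      qed
      then show "A *v y \<in> T" by (simp add: T_def orthogonal_def)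
    qed
    ultimately obtain v where v: "v \<in> T" "norm v = 1" "A *v v = (v \<bullet> (A *v v)) *\<^sub>R v"
      using self_adjoint_eigenvector[of "(*v) A" T] adj by (metis matrix_vector_mul_linear)
    \<comment> \<open>The eigenvalue is the square of a nonnegative number, the form that
      \<open>singular_values\<close> asks for.\<close>
    have "v \<bullet> (A *v v) = (norm (X *v v))\<^sup>2"
      by (simp add: A_def adj[unfolded A_def, symmetric] gram_inner power2_norm_eq_inner)
    then have vE: "v \<in> E (norm (X *v v))"
      using v by (simp add: E_def eigenspace_def)
    moreover have "v \<noteq> 0" using v by auto
    ultimately have "norm (X *v v) \<in> ?S"
      by (auto simp: singular_values_def E_def A_def)
    then have "v \<in> span B"
      using vE C(6) span_mono[of "C (norm (X *v v))" B] by (auto simp: B_def)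
    moreover have "\<And>b. b \<in> B \<Longrightarrow> orthogonal v b"
      using v by (simp add: T_def orthogonal_commute)
    ultimately have "orthogonal v v"
      by (rule orthogonal_to_span)
    with \<open>v \<noteq> 0\<close> show False by (simp add: orthogonal_self)
  qed
  have 5: "pairwise (\<lambda>b c. orthogonal (X *v b) (X *v c)) B"
  proof (rule pairwiseI)
    fix b c assume bc: "b \<in> B" "c \<in> B" "b \<noteq> c"
    then obtain \<sigma> where "b \<in> E \<sigma>" using C(1) unfolding B_def by blast
    moreover have "b \<bullet> c = 0" using 2 bc by (auto simp: pairwise_def orthogonal_def)
    ultimately have "(A *v b) \<bullet> c = 0" by (simp add: Eeq)
    then show "orthogonal (X *v b) (X *v c)"
      by (simp add: A_def gram_inner orthogonal_def)
  qed
  have norm_C: "norm (X *v b) = \<sigma>" if "\<sigma> \<in> ?S" "b \<in> C \<sigma>" for b \<sigma>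
  proof -
    have "(norm (X *v b))\<^sup>2 = (A *v b) \<bullet> b"
      by (simp add: A_def gram_inner power2_norm_eq_inner)
    also have "\<dots> = \<sigma>\<^sup>2"
      using that C(1,3) Eeq by (metis inner_scaleR_left mult.right_neutral norm_eq_1 subsetD)
    finally show ?thesis using S_nonneg that by (simp add: power2_eq_iff_nonneg)
  qed
  have "(\<Sum>b\<in>B. norm (X *v b)) = (\<Sum>\<sigma>\<in>?S. \<Sum>b\<in>C \<sigma>. norm (X *v b))"
    unfolding B_def
  proof (rule sum.UNION_disjoint)
    \<comment> \<open>A vector common to \<open>C \<sigma>\<close> and \<open>C \<tau>\<close> would
      have an image of norm both \<open>\<sigma>\<close> and \<open>\<tau>\<close>.\<close>
    show "\<forall>\<sigma>\<in>?S. \<forall>\<tau>\<in>?S. \<sigma> \<noteq> \<tau> \<longrightarrow> C \<sigma> \<inter> C \<tau> = {}"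
      using norm_C by blast
  qed (auto simp: finite_singular_values finC)
  also have "\<dots> = (\<Sum>\<sigma>\<in>?S. real (card (C \<sigma>)) * \<sigma>)"
    by (intro sum.cong refl) (simp add: norm_C)
  also have "\<dots> = nuclear_norm X"
    by (simp add: nuclear_norm_def C(5) E_def A_def)
  finally show thesis using that 1 2 3 4 5 by metis
qed

text \<open>The upper bound in the support function formula. Expanding every \<open>b\<close> in an
  eigenbasis \<open>D\<close> of \<open>transpose X ** X\<close> turns the left side into a sum over
  \<open>D\<close> of inner products of \<open>X *v d\<close> with vectors of norm at most 1, and
  Cauchy-Schwarz bounds each term by \<open>norm (X *v d)\<close>.\<close>

lemma sum_inner_le_nuclear_norm:
  fixes X :: "real ^ 'n ^ 'n"
  assumes B: "finite B" "pairwise orthogonal B" "\<And>b. b \<in> B \<Longrightarrow> norm b = 1" "span B = UNIV"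
    and c: "pairwise (\<lambda>a b. orthogonal (c a) (c b)) B" "\<And>b. b \<in> B \<Longrightarrow> norm (c b) \<le> 1"
  shows "(\<Sum>b\<in>B. c b \<bullet> (X *v b)) \<le> nuclear_norm X"
proof -
  obtain D where D: "finite D" "pairwise orthogonal D" "\<And>d. d \<in> D \<Longrightarrow> norm d = 1" "span D = UNIV"
    and nn: "nuclear_norm X = (\<Sum>d\<in>D. norm (X *v d))"
    by (rule nuclear_norm_eigenbasis[of X]) metis
  have Xb: "X *v b = (\<Sum>d\<in>D. (b \<bullet> d) *\<^sub>R (X *v d))" for b
  proof -
    have "X *v b = X *v (\<Sum>d\<in>D. (b \<bullet> d) *\<^sub>R d)"
      by (rule arg_cong[OF orthonormal_basis_expansion[OF D]])
    also have "\<dots> = (\<Sum>d\<in>D. X *v ((b \<bullet> d) *\<^sub>R d))"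
      by (rule linear_sum[OF Finite_Cartesian_Product.matrix_vector_mul_linear])
    finally show ?thesis by (simp add: matrix_vector_mult_scaleR)
  qed
  have "(\<Sum>b\<in>B. c b \<bullet> (X *v b)) = (\<Sum>b\<in>B. \<Sum>d\<in>D. (b \<bullet> d) * (c b \<bullet> (X *v d)))"
    by (subst Xb) (simp add: inner_sum_right)
  also have "\<dots> = (\<Sum>d\<in>D. (\<Sum>b\<in>B. (b \<bullet> d) *\<^sub>R c b) \<bullet> (X *v d))"
    by (subst sum.swap) (simp add: inner_sum_left)
  also have "\<dots> \<le> (\<Sum>d\<in>D. norm (X *v d))"
  proof (rule sum_mono)
    fix d assume d: "d \<in> D"
    \<comment> \<open>\<open>?e\<close> is the image of \<open>d\<close> under the linear map taking
      each \<open>b\<close> to \<open>c b\<close>. Since the \<open>c b\<close> are orthogonal with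
      norm at most 1, Pythagoras makes this map a contraction.\<close>
    let ?e = "\<Sum>b\<in>B. (b \<bullet> d) *\<^sub>R c b"
    have "(norm ?e)\<^sup>2 = (\<Sum>b\<in>B. (norm ((b \<bullet> d) *\<^sub>R c b))\<^sup>2)"
      using c(1) by (intro norm_sum_Pythagorean B) (auto simp: pairwise_def orthogonal_def)
    also have "\<dots> \<le> (\<Sum>b\<in>B. (norm ((d \<bullet> b) *\<^sub>R b))\<^sup>2)"
    proof (rule sum_mono)
      fix b assume b: "b \<in> B"
      have "\<bar>b \<bullet> d\<bar> * norm (c b) \<le> \<bar>b \<bullet> d\<bar>"
        using c(2)[OF b] by (simp add: mult_left_le)
      then show "(norm ((b \<bullet> d) *\<^sub>R c b))\<^sup>2 \<le> (norm ((d \<bullet> b) *\<^sub>R b))\<^sup>2"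
        using B(3)[OF b] by (intro power_mono) (simp_all add: inner_commute)
    qed
    also have "\<dots> = (norm (\<Sum>b\<in>B. (d \<bullet> b) *\<^sub>R b))\<^sup>2"
      using B(2) by (intro norm_sum_Pythagorean[symmetric] B) (auto simp: pairwise_def orthogonal_def)
    also have "\<dots> = 1"
      using orthonormal_basis_expansion[OF B, of d] D(3)[OF d] by simp
    finally have "norm ?e \<le> 1"
      by (simp add: power_le_one_iff)
    then have "norm ?e * norm (X *v d) \<le> norm (X *v d)"
      by (simp add: mult_left_le_one_le)
    with norm_cauchy_schwarz[of ?e "X *v d"]
    show "?e \<bullet> (X *v d) \<le> norm (X *v d)" by linarith
  qed
  finally show ?thesis by (simp add: nn)
qed

lemma inverse_mult_self_le_1: "inverse x * x \<le> (1::real)"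
  by (cases "x = 0") auto

text \<open>The pair \<open>B\<close>, \<open>c\<close> is chosen to attain the support function at
  the convex combination \<open>Z\<close>. For this fixed pair the sum is linear in the matrix, and
  at \<open>X\<close> and \<open>Y\<close> it is bounded by the nuclear norm.\<close>

lemma convex_on_nuclear_norm: "convex_on UNIV (nuclear_norm :: real ^ 'n ^ 'n \<Rightarrow> real)"
proof (rule convex_onI)
  fix t :: real and X Y :: "real ^ 'n ^ 'n"
  assume t: "0 < t" "t < 1"
  define Z where "Z = (1 - t) *\<^sub>R X + t *\<^sub>R Y"
  obtain B where B: "finite B" "pairwise orthogonal B" "\<And>b. b \<in> B \<Longrightarrow> norm b = 1" "span B = UNIV"
    and Zorth: "pairwise (\<lambda>b c. orthogonal (Z *v b) (Z *v c)) B"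
    and nn: "nuclear_norm Z = (\<Sum>b\<in>B. norm (Z *v b))"
    by (rule nuclear_norm_eigenbasis[of Z]) metis
  \<comment> \<open>\<open>c b\<close> is \<open>0\<close> when \<open>Z *v b = 0\<close>\<close>
  define c where "c b = (Z *v b) /\<^sub>R norm (Z *v b)" for b
  have c: "pairwise (\<lambda>a b. orthogonal (c a) (c b)) B" "\<And>b. b \<in> B \<Longrightarrow> norm (c b) \<le> 1"
    using Zorth by (auto simp: pairwise_def orthogonal_def c_def inverse_mult_self_le_1)
  have Zb: "Z *v b = (1 - t) *\<^sub>R (X *v b) + t *\<^sub>R (Y *v b)" for b
    by (simp add: Z_def matrix_vector_mult_add_rdistrib scaleR_matrix_vector_assoc)
  have "norm (Z *v b) = c b \<bullet> (Z *v b)" for b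
    by (cases "Z *v b = 0") (simp_all add: c_def power2_norm_eq_inner[symmetric] power2_eq_square)
  then have "nuclear_norm Z = (\<Sum>b\<in>B. c b \<bullet> (Z *v b))"
    by (simp add: nn)
  also have "\<dots> = (1 - t) * (\<Sum>b\<in>B. c b \<bullet> (X *v b)) + t * (\<Sum>b\<in>B. c b \<bullet> (Y *v b))"
    by (simp add: Zb inner_add_right sum.distrib sum_distrib_left)
  also have "\<dots> \<le> (1 - t) * nuclear_norm X + t * nuclear_norm Y"
    using t by (intro add_mono mult_left_mono sum_inner_le_nuclear_norm B c) auto
  finally show "nuclear_norm ((1 - t) *\<^sub>R X + t *\<^sub>R Y) \<le> (1 - t) * nuclear_norm X + t * nuclear_norm Y"
    by (simp add: Z_def)
qed simp

lemma nuclear_norm_nonneg: "0 \<le> nuclear_norm X"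
  by (auto simp: nuclear_norm_def singular_values_def intro!: sum_nonneg)

lemma convex_on_l1_norm: "convex_on UNIV (l1_norm :: real ^ 'n ^ 'n \<Rightarrow> real)"
proof (rule convex_onI)
  fix t :: real and X Y :: "real ^ 'n ^ 'n"
  assume t: "0 < t" "t < 1"
  have "\<bar>(1 - t) * x + t * y\<bar> \<le> (1 - t) * \<bar>x\<bar> + t * \<bar>y\<bar>" for x y :: real
    using t by (intro order_trans[OF abs_triangle_ineq]) (simp add: abs_mult)
  then show "l1_norm ((1 - t) *\<^sub>R X + t *\<^sub>R Y) \<le> (1 - t) * l1_norm X + t * l1_norm Y"
    by (simp add: l1_norm_def sum_distrib_left sum.distrib[symmetric] sum_mono)
qed simp

lemma l1_norm_nonneg: "0 \<le> l1_norm X"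
  by (simp add: l1_norm_def sum_nonneg)

subsection \<open>The objective and the feasible set\<close>

lemma convex_on_compose_mono:
  fixes f :: "'a::real_vector \<Rightarrow> real"
  assumes f: "convex_on S f" "\<And>x. x \<in> S \<Longrightarrow> f x \<in> T"
    and \<phi>: "convex_on T \<phi>" "mono_on T \<phi>"
  shows "convex_on S (\<lambda>x. \<phi> (f x))"
proof (rule convex_onI)
  show S: "convex S" using f(1) by (rule convex_on_imp_convex)
  fix t :: real and x y assume *: "0 < t" "t < 1" "x \<in> S" "y \<in> S"
  have "(1 - t) *\<^sub>R x + t *\<^sub>R y \<in> S" using S * by (simp add: convexD)
  moreover have "(1 - t) *\<^sub>R f x + t *\<^sub>R f y \<in> T"
    using convex_on_imp_convex[OF \<phi>(1)] * f(2) by (simp add: convexD del: real_scaleR_def)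
  ultimately have "\<phi> (f ((1 - t) *\<^sub>R x + t *\<^sub>R y)) \<le> \<phi> ((1 - t) * f x + t * f y)"
    using * f convex_onD[OF f(1), of t x y] by (intro mono_onD[OF \<phi>(2)]) auto
  also have "\<dots> \<le> (1 - t) * \<phi> (f x) + t * \<phi> (f y)"
    using convex_onD[OF \<phi>(1), of t "f x" "f y"] * f(2) by simp
  finally show "\<phi> (f ((1 - t) *\<^sub>R x + t *\<^sub>R y)) \<le> (1 - t) * \<phi> (f x) + t * \<phi> (f y)" .
qed

text \<open>Two positive points are handled by \<open>powr_convex\<close>. If one point is 0, its
  term vanishes and the claim reduces to \<open>s powr p \<le> s\<close> for \<open>s\<close>
  strictly between 0 and 1.\<close>

lemma convex_on_powr_nonneg:
  assumes "1 \<le> p"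
  shows "convex_on {0..} (\<lambda>x::real. x powr p)"
proof (rule convex_onI)
  have scale: "(s * x) powr p \<le> s * x powr p" if "0 < s" "s < 1" "0 \<le> x" for s x :: real
  proof -
    have "s powr p \<le> s powr 1" using that assms by (intro powr_mono') auto
    then have "s powr p \<le> s" using that by simp
    then show ?thesis using that by (simp add: powr_mult mult_right_mono)
  qed
  fix t x y :: real assume *: "0 < t" "t < 1" "x \<in> {0..}" "y \<in> {0..}"
  consider "x = 0" | "y = 0" | "0 < x" "0 < y" using * by fastforce
  then show "((1 - t) *\<^sub>R x + t *\<^sub>R y) powr p \<le> (1 - t) * x powr p + t * y powr p"
  proof cases
    case 1 then show ?thesis using * scale[of t y] by simp
  next
    case 2 then show ?thesis using * scale[of "1 - t" x] by simp
  next
    case 3 then show ?thesis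
      using convex_onD[OF powr_convex[OF assms], of t x y] * by simp
  qed
qed simp

text \<open>Both terms are nonnegative convex functions followed by a map that is convex and
  increasing on \<open>{0..}\<close>: the power \<open>p\<close> after \<open>nrm\<close>, and the
  square after the norm of an affine function.\<close>

lemma convex_on_objective:
  fixes nrm :: "real ^ 'n ^ 'n \<Rightarrow> real" and M :: "real ^ 'n ^ 'm"
  assumes nrm: "convex_on UNIV nrm" "\<And>X. 0 \<le> nrm X" and p: "1 \<le> p" and lam: "0 \<le> lam"
  shows "convex_on UNIV (\<lambda>X. lam * nrm X powr p + 1/2 * (norm (M ** X - M))\<^sup>2)"
proof -
  have "convex_on UNIV (\<lambda>X. nrm X powr p)"
    using nrm p
    by (intro convex_on_compose_mono[where f = nrm and T = "{0..}" and \<phi> = "\<lambda>x. x powr p"]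
        convex_on_powr_nonneg mono_onI powr_mono2) auto
  moreover have "convex_on UNIV (\<lambda>X. norm (M ** X - M))"
  proof (rule convex_onI)
    fix t :: real and X Y :: "real ^ 'n ^ 'n"
    assume t: "0 < t" "t < 1"
    have "M ** ((1 - t) *\<^sub>R X + t *\<^sub>R Y) = (1 - t) *\<^sub>R (M ** X) + t *\<^sub>R (M ** Y)"
      by (simp add: matrix_add_ldistrib matrix_scalar_ac scalar_matrix_assoc[symmetric])
    then have "M ** ((1 - t) *\<^sub>R X + t *\<^sub>R Y) - M = (1 - t) *\<^sub>R (M ** X - M) + t *\<^sub>R (M ** Y - M)"
      by (simp add: algebra_simps)
    then show "norm (M ** ((1 - t) *\<^sub>R X + t *\<^sub>R Y) - M) \<le> (1 - t) * norm (M ** X - M) + t * norm (M ** Y - M)"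
      using t by (metis (no_types, opaque_lifting) abs_of_pos diff_gt_0_iff_gt norm_scaleR norm_triangle_ineq)
  qed simp
  then have "convex_on UNIV (\<lambda>X. (norm (M ** X - M))\<^sup>2)"
    by (rule convex_on_compose_mono[where T = "{0..}" and \<phi> = "power2"])
      (auto simp: intro!: mono_onI power_mono convex_on_subset[OF convex_power2])
  ultimately show ?thesis
    using lam by (intro convex_on_add convex_on_cmul) auto
qed

lemma convex_Omega: "convex (Omega w)"
proof (rule convexI)
  fix X Y and u v :: real
  assume *: "X \<in> Omega w" "Y \<in> Omega w" "0 \<le> u" "0 \<le> v" "u + v = 1"
  have "0 \<le> u * X $ i $ j + v * Y $ i $ j" for i j
    using * by (simp add: Omega_def)
  moreover have "u * X $ i $ i + v * Y $ i $ i \<le> 1" for i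
    using * by (intro convex_bound_le) (auto simp: Omega_def)
  moreover have "w $ i * (u * X $ i $ j + v * Y $ i $ j) \<le> w $ j * (u * X $ i $ i + v * Y $ i $ i)" for i j
  proof -
    have "u * (w $ i * X $ i $ j) + v * (w $ i * Y $ i $ j)
        \<le> u * (w $ j * X $ i $ i) + v * (w $ j * Y $ i $ i)"
      using * by (intro add_mono mult_left_mono) (auto simp: Omega_def)
    then show ?thesis by (simp add: algebra_simps)
  qed
  ultimately show "u *\<^sub>R X + v *\<^sub>R Y \<in> Omega w"
    by (simp add: Omega_def)
qed

lemma closed_Omega: "closed (Omega w)"
  unfolding Omega_def by (intro closed_Collect_conj closed_Collect_all closed_Collect_le continuous_intros)

text \<open>Minimality is tested only along the segment from \<open>x\<close> to \<open>y\<close>.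
  There convexity bounds \<open>G\<close> by its chord, and the quadratic expands exactly. Dividing
  by \<open>t\<close> and letting \<open>t\<close> tend to 0 removes the second-order term and
  leaves the subgradient inequality.\<close>

lemma convex_proximal_minimizer:
  fixes G :: "'a::real_inner \<Rightarrow> real"
  assumes G: "convex_on S G" and x: "x \<in> S" and y: "y \<in> S"
    and min: "\<And>y. y \<in> S \<Longrightarrow>
      G x - a \<bullet> x + \<beta> / 2 * (norm (x - z))\<^sup>2 \<le> G y - a \<bullet> y + \<beta> / 2 * (norm (y - z))\<^sup>2"
  shows "G x + (a - \<beta> *\<^sub>R (x - z)) \<bullet> (y - x) \<le> G y"
proof -
  define d where "d = y - x"
  have ineq: "(a - \<beta> *\<^sub>R (x - z)) \<bullet> d - t * (\<beta> / 2 * (d \<bullet> d)) \<le> G y - G x" if t: "0 < t" "t < 1" for t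
  proof -
    have eq: "(1 - t) *\<^sub>R x + t *\<^sub>R y = x + t *\<^sub>R d"
      by (simp add: d_def algebra_simps)
    have "x + t *\<^sub>R d \<in> S"
      using convexD[OF convex_on_imp_convex[OF G] x y, of "1 - t" t] t eq by simp
    note min[OF this]
    moreover have "G (x + t *\<^sub>R d) \<le> (1 - t) * G x + t * G y"
      using convex_onD[OF G, of t x y] x y t eq by simp
    moreover have "(norm (x + t *\<^sub>R d - z))\<^sup>2
        = (norm (x - z))\<^sup>2 + 2 * t * ((x - z) \<bullet> d) + t * t * (d \<bullet> d)"
      by (simp add: power2_norm_eq_inner inner_diff_left inner_diff_right inner_add_left
          inner_add_right inner_commute algebra_simps)
    ultimately have "t * ((a - \<beta> *\<^sub>R (x - z)) \<bullet> d - t * (\<beta> / 2 * (d \<bullet> d))) \<le> t * (G y - G x)"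
      by (simp add: inner_add_right inner_diff_left algebra_simps)
    then show ?thesis using t by simp
  qed
  have "((\<lambda>t. (a - \<beta> *\<^sub>R (x - z)) \<bullet> d - t * (\<beta> / 2 * (d \<bullet> d)))
      \<longlongrightarrow> (a - \<beta> *\<^sub>R (x - z)) \<bullet> d - 0 * (\<beta> / 2 * (d \<bullet> d))) (at_right 0)"
    by (intro tendsto_intros)
  moreover
  have "eventually (\<lambda>t::real. 0 < t \<and> t < 1) (at_right 0)"
    by (rule eventually_at_rightI[of 0 1]) auto
  then have "eventually (\<lambda>t. (a - \<beta> *\<^sub>R (x - z)) \<bullet> d - t * (\<beta> / 2 * (d \<bullet> d)) \<le> G y - G x) (at_right 0)"
    by (rule eventually_mono) (use ineq in blast)
  ultimately have "(a - \<beta> *\<^sub>R (x - z)) \<bullet> d - 0 * (\<beta> / 2 * (d \<bullet> d)) \<le> G y - G x"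
    by (rule tendsto_upperbound) simp
  then show ?thesis by (simp add: d_def)
qed

section \<open>Descent, stationarity and limits of the proximal iteration\<close>

theorem theorem3p2:
  fixes nrm :: "real ^ 'n ^ 'n \<Rightarrow> real"
    and p lam \<beta> :: real
    and M :: "real ^ 'n ^ 'm"
    and w :: "real ^ 'n"
    and X :: "nat \<Rightarrow> real ^ 'n ^ 'n"
    and \<alpha> :: "nat \<Rightarrow> real"
    and g h :: "real ^ 'n ^ 'n \<Rightarrow> ereal"
    and \<Phi> :: "nat \<Rightarrow> real ^ 'n ^ 'n \<Rightarrow> ereal"
  assumes nrm: "nrm = l1_norm \<or> nrm = nuclear_norm"
    and p: "1 \<le> p" and lam: "0 < lam" and beta: "0 < \<beta>"
    and M_nonneg: "\<And>i j. 0 \<le> M $ i $ j" and M_nonzero: "M \<noteq> 0"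
    and w_nonneg: "\<And>i. 0 \<le> w $ i"
    and g_def: "g = g_fun nrm p lam M w"
    and h_def: "h = h_fun"
    and X0: "X 0 \<in> Omega w"
    and alpha_def: "\<And>k. \<alpha> k = R_ratio nrm p (X k)"
    and step: "\<And>k. is_arg_min
        (\<lambda>Y. g Y - ereal (\<alpha> k * (Y \<bullet> (X k /\<^sub>R norm (X k)))) + ereal (\<beta> / 2 * (norm (Y - X k))\<^sup>2))
        (\<lambda>_. True) (X (Suc k))"
    and X_nonzero: "\<And>k. X k \<noteq> 0"
    and Phi_def: "\<And>k Y. \<Phi> k Y = g Y - ereal (\<alpha> k) * h Y"
  shows "(\<forall>k. \<Phi> k (X (Suc k)) + ereal (\<beta> / 2 * (norm (X (Suc k) - X k))\<^sup>2) \<le> \<Phi> k (X k)) \<and>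
    (\<forall>k. 0 \<in> {s - \<alpha> k *\<^sub>R (X k /\<^sub>R norm (X k)) + \<beta> *\<^sub>R (X (Suc k) - X k) | s.
                s \<in> subdifferential g (X (Suc k))}) \<and>
    (\<forall>Xstar \<alpha>star. X \<longlonglongrightarrow> Xstar \<and> Xstar \<noteq> 0 \<and> \<alpha> \<longlonglongrightarrow> \<alpha>star \<longrightarrow>
        0 \<in> {s - \<alpha>star *\<^sub>R t | s t. s \<in> subdifferential g Xstar \<and> t \<in> subdifferential h Xstar})"
proof -
  \<comment> \<open>\<open>G\<close> is the finite part of \<open>g\<close>. Since \<open>g\<close>
    is infinite off \<open>Omega w\<close>, the extended-real claims become real inequalities for
    \<open>G\<close> on \<open>Omega w\<close>.\<close>
  define G where "G Y = lam * nrm Y powr p + 1/2 * (norm (M ** Y - M))\<^sup>2" for Y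
  have "convex_on UNIV nrm" "\<And>Y. 0 \<le> nrm Y"
    using nrm convex_on_l1_norm convex_on_nuclear_norm l1_norm_nonneg nuclear_norm_nonneg by auto
  then have convG: "convex_on UNIV G"
    unfolding G_def using p lam by (intro convex_on_objective) auto
  have contG: "continuous_on UNIV G"
    using convG by (intro convex_on_continuous) auto
  have g_in: "g Y = ereal (G Y)" if "Y \<in> Omega w" for Y
    using that by (simp add: g_def g_fun_def G_def convex_indicator_def)
  have g_out: "g Y = \<infinity>" if "Y \<notin> Omega w" for Y
    using that by (simp add: g_def g_fun_def convex_indicator_def)
  have subdiffI: "s \<in> subdifferential g Y"
    if "Y \<in> Omega w" "\<And>Z. Z \<in> Omega w \<Longrightarrow> G Y + s \<bullet> (Z - Y) \<le> G Z" for s Y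
    unfolding subdifferential_def
  proof (intro CollectI conjI allI)
    show "\<bar>g Y\<bar> \<noteq> \<infinity>" using that by (simp add: g_in)
    show "g Y + ereal (s \<bullet> (Z - Y)) \<le> g Z" for Z
      using that by (cases "Z \<in> Omega w") (auto simp: g_in g_out)
  qed
  define U where "U k = X k /\<^sub>R norm (X k)" for k
  have min: "g (X (Suc k)) - ereal (\<alpha> k * (X (Suc k) \<bullet> U k)) + ereal (\<beta> / 2 * (norm (X (Suc k) - X k))\<^sup>2)
      \<le> g Y - ereal (\<alpha> k * (Y \<bullet> U k)) + ereal (\<beta> / 2 * (norm (Y - X k))\<^sup>2)" for k Y
    using step[of k] unfolding is_arg_min_linorder U_def by simp
  \<comment> \<open>An infeasible iterate would have infinite objective value, while the feasible
    competitor \<open>X 0\<close> has a finite one.\<close>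
  have X_in: "X k \<in> Omega w" for k
  proof (cases k)
    case (Suc m)
    show ?thesis
    proof (rule ccontr)
      assume "X k \<notin> Omega w"
      then show False
        using min[of m "X 0"] X0 by (simp add: g_in g_out Suc)
    qed
  qed (use X0 in simp)
  have min_real: "G (X (Suc k)) - \<alpha> k * (X (Suc k) \<bullet> U k) + \<beta> / 2 * (norm (X (Suc k) - X k))\<^sup>2
      \<le> G Y - \<alpha> k * (Y \<bullet> U k) + \<beta> / 2 * (norm (Y - X k))\<^sup>2" if "Y \<in> Omega w" for k Y
    using min[of k Y] that by (simp add: g_in X_in)
  \<comment> \<open>The only candidate subgradient: the stationarity equation solved for
    \<open>s\<close>.\<close>
  define s where "s k = \<alpha> k *\<^sub>R U k - \<beta> *\<^sub>R (X (Suc k) - X k)" for k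
  have s_le: "G (X (Suc k)) + s k \<bullet> (Y - X (Suc k)) \<le> G Y" if "Y \<in> Omega w" for k Y
    unfolding s_def
  proof (rule convex_proximal_minimizer[where S = "Omega w"])
    show "convex_on (Omega w) G"
      using convG convex_Omega by (auto intro: convex_on_subset)
    show "G (X (Suc k)) - (\<alpha> k *\<^sub>R U k) \<bullet> X (Suc k) + \<beta> / 2 * (norm (X (Suc k) - X k))\<^sup>2
        \<le> G Z - (\<alpha> k *\<^sub>R U k) \<bullet> Z + \<beta> / 2 * (norm (Z - X k))\<^sup>2" if "Z \<in> Omega w" for Z
      using min_real[OF that, of k] by (simp add: inner_commute)
  qed (use that X_in in auto)

  have descent: "\<Phi> k (X (Suc k)) + ereal (\<beta> / 2 * (norm (X (Suc k) - X k))\<^sup>2) \<le> \<Phi> k (X k)" for k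
  proof -
    \<comment> \<open>The linear function with gradient \<open>U k\<close> lies below the norm and
      agrees with it at \<open>X k\<close>. As \<open>\<alpha> k\<close> is nonnegative, the
      subproblem objective without its proximal term majorises \<open>\<Phi> k\<close> with equality
      at \<open>X k\<close>, so comparing with \<open>Y = X k\<close> gives descent.\<close>
    have "X (Suc k) \<bullet> U k \<le> norm (X (Suc k)) * norm (U k)"
      by (rule norm_cauchy_schwarz)
    then have "X (Suc k) \<bullet> U k \<le> norm (X (Suc k))"
      using X_nonzero by (simp add: U_def)
    moreover have "0 \<le> \<alpha> k"
      by (simp add: alpha_def R_ratio_def)
    ultimately have "\<alpha> k * (X (Suc k) \<bullet> U k) \<le> \<alpha> k * norm (X (Suc k))"
      by (rule mult_left_mono)
    moreover have "X k \<bullet> U k = norm (X k)"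
      using X_nonzero[of k] by (simp add: U_def power2_norm_eq_inner[symmetric] power2_eq_square)
    ultimately show ?thesis
      using min_real[OF X_in, of k k] by (simp add: Phi_def h_def h_fun_def g_in X_in)
  qed
  have optimality: "0 \<in> {s - \<alpha> k *\<^sub>R (X k /\<^sub>R norm (X k)) + \<beta> *\<^sub>R (X (Suc k) - X k) | s.
      s \<in> subdifferential g (X (Suc k))}" for k
  proof -
    have "s k \<in> subdifferential g (X (Suc k))"
      by (intro subdiffI X_in s_le)
    moreover have "0 = s k - \<alpha> k *\<^sub>R (X k /\<^sub>R norm (X k)) + \<beta> *\<^sub>R (X (Suc k) - X k)"
      by (simp add: s_def U_def)
    ultimately show ?thesis by blast
  qed
  have limit: "0 \<in> {s - \<alpha>star *\<^sub>R t | s t. s \<in> subdifferential g Xstar \<and> t \<in> subdifferential h Xstar}"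
    if lim: "X \<longlonglongrightarrow> Xstar" "Xstar \<noteq> 0" "\<alpha> \<longlonglongrightarrow> \<alpha>star" for Xstar \<alpha>star
  proof -
    define t where "t = Xstar /\<^sub>R norm Xstar"
    have XS: "(\<lambda>k. X (Suc k)) \<longlonglongrightarrow> Xstar"
      using lim(1) by (rule LIMSEQ_Suc)
    have star_in: "Xstar \<in> Omega w"
      using closed_sequentially[OF closed_Omega X_in lim(1)] .
    \<comment> \<open>Consecutive iterates share the limit, so the proximal term vanishes.
      Normalisation is continuous at \<open>Xstar\<close> because \<open>Xstar\<close> is
      nonzero.\<close>
    have "(\<lambda>k. \<alpha> k *\<^sub>R (X k /\<^sub>R norm (X k)) - \<beta> *\<^sub>R (X (Suc k) - X k))
        \<longlonglongrightarrow> \<alpha>star *\<^sub>R (Xstar /\<^sub>R norm Xstar) - \<beta> *\<^sub>R (Xstar - Xstar)"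
      using lim XS by (intro tendsto_intros) auto
    then have s_lim: "s \<longlonglongrightarrow> \<alpha>star *\<^sub>R t"
      by (simp add: s_def[abs_def] U_def t_def)
    have G_lim: "(\<lambda>k. G (X (Suc k))) \<longlonglongrightarrow> G Xstar"
      using continuous_on_tendsto_compose[OF contG XS] by simp
    have "\<alpha>star *\<^sub>R t \<in> subdifferential g Xstar"
    proof (rule subdiffI[OF star_in])
      fix Z assume "Z \<in> Omega w"
      \<comment> \<open>With \<open>Z\<close> fixed, the inequality \<open>s_le\<close> passes to
        the limit; continuity of \<open>G\<close> keeps the value at \<open>Xstar\<close>
        exact.\<close>
      have "(\<lambda>k. G (X (Suc k)) + s k \<bullet> (Z - X (Suc k)))
          \<longlonglongrightarrow> G Xstar + (\<alpha>star *\<^sub>R t) \<bullet> (Z - Xstar)"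
        by (intro tendsto_intros G_lim s_lim XS)
      then show "G Xstar + (\<alpha>star *\<^sub>R t) \<bullet> (Z - Xstar) \<le> G Z"
        using s_le[OF \<open>Z \<in> Omega w\<close>] by (intro LIMSEQ_le_const2) auto
    qed
    moreover have "t \<in> subdifferential h Xstar"
    proof -
      \<comment> \<open>A linear function below the norm that touches it at \<open>Xstar\<close>
        supplies a subgradient of the norm there.\<close>
      have "t \<bullet> Z \<le> norm Z" for Z
        using norm_cauchy_schwarz[of t Z] lim(2) by (simp add: t_def)
      moreover have "t \<bullet> Xstar = norm Xstar"
        using lim(2) by (simp add: t_def power2_norm_eq_inner[symmetric] power2_eq_square)
      ultimately show ?thesis
        by (simp add: subdifferential_def h_def h_fun_def inner_diff_right)
    qed
    moreover have "0 = \<alpha>star *\<^sub>R t - \<alpha>star *\<^sub>R t" by simp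
    ultimately show ?thesis by blast
  qed
  show ?thesis
    using descent optimality limit by blast
qed

end
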